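(* Let $m,n\ge 1$ be integers, let $A\in\mathbb{Z}^{m\times n}$ with $A\neq 0$, $b\in\mathbb{Z}^m$, $c\in\mathbb{R}^n$, and let $\Delta=\Delta(A)$ be the largest absolute value of any determinant of a square submatrix of $A$. Let $I,J\subseteq[n]$ with $I\neq J$ be such that ($J$-MIP) has an optimal solution. Then for every optimal solution $w$ of ($I$-MIP), there exists an optimal solution $z$ of ($J$-MIP) such that $\|w-z\|_\infty<|I\cup J|\,\Delta$.
   Context: Notation: $[n]=\{1,\dots,n\}$. For $K\subseteq[n]$, ($K$-MIP) denotes the mixed-integer linear program $$\max\{c^\intercal x : x\in\mathbb{R}^n,\ Ax\le b,\ x_i\in\mathbb{Z}\text{ for all }i\in K\}.$$ In particular ($[n]$-MIP) is a pure integer linear program and ($\emptyset$-MIP) is its linear programming relaxation. An optimal solution of ($K$-MIP) is a feasible point $x$ attaining this maximum. Square submatrices of $A$ are of any size $k\times k$ with $k\ge1$, obtained by selecting $k$ rows and $k$ columns of $A$. $\|\cdot\|_\infty$ is the maximum norm on $\mathbb{R}^n$. *)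

theory Defs
  imports
    Complex_Main
    "Jordan_Normal_Form.Determinant"
    "Jordan_Normal_Form.DL_Submatrix"
begin

text \<open>Vectors and matrices are indexed from 0, so the index set \<open>[n]\<close> is \<open>{0..<n}\<close>.
  The order on vectors is the componentwise one.\<close>

definition mip_feasible :: "int mat \<Rightarrow> int vec \<Rightarrow> nat set \<Rightarrow> real vec set" where
  "mip_feasible A b K =
     {x \<in> carrier_vec (dim_col A).
        map_mat real_of_int A *\<^sub>v x \<le> map_vec real_of_int b \<and> (\<forall>i\<in>K. x $ i \<in> \<int>)}"

definition mip_optimal :: "int mat \<Rightarrow> int vec \<Rightarrow> real vec \<Rightarrow> nat set \<Rightarrow> real vec \<Rightarrow> bool" where
  "mip_optimal A b c K x \<longleftrightarrow>
     x \<in> mip_feasible A b K \<and> (\<forall>y \<in> mip_feasible A b K. c \<bullet> y \<le> c \<bullet> x)"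

text \<open>Rows and columns are selected as index sets; selecting them in another order only
  changes the sign of the determinant.\<close>

definition abs_minors :: "'a :: linordered_idom mat \<Rightarrow> 'a set" where
  "abs_minors A =
     {\<bar>det (submatrix A R C)\<bar> | R C.
        R \<subseteq> {0..<dim_row A} \<and> C \<subseteq> {0..<dim_col A} \<and> card R = card C \<and> card R \<ge> 1}"

definition max_minor :: "'a :: linordered_idom mat \<Rightarrow> 'a" where
  "max_minor A = Max (abs_minors A)"

lemma finite_abs_minors: "finite (abs_minors A)"
proof -
  have "abs_minors A \<subseteq> (\<lambda>(R, C). \<bar>det (submatrix A R C)\<bar>) `
          (Pow {0..<dim_row A} \<times> Pow {0..<dim_col A})"
    unfolding abs_minors_def by auto
  then show ?thesis by (rule finite_subset) auto
qed

lemma abs_minors_nonempty: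
  assumes "dim_row A \<ge> 1" "dim_col A \<ge> 1"
  shows "abs_minors A \<noteq> {}"
proof -
  have "\<bar>det (submatrix A {0} {0})\<bar> \<in> abs_minors A"
    unfolding abs_minors_def using assms
    by (intro CollectI exI[of _ "{0}"]) auto
  then show ?thesis by blast
qed

text \<open>Only meaningful for vectors of positive dimension.\<close>

definition max_norm_vec :: "'a :: linordered_idom vec \<Rightarrow> 'a" where
  "max_norm_vec v = Max ((\<lambda>i. \<bar>v $ i\<bar>) ` {0..<dim_vec v})"

end

(*
  Let w be optimal for (I-MIP), let z0 be optimal for (J-MIP), and put d = |I Un J|. The difference
  z0 - w is a nonnegative combination of integer vectors v with entries at most Delta in absolute
  value such that the signs of A v agree with those of A (z0 - w). From the coefficients nu of the
  combination one can split off gamma with 0 <= gamma <= nu such that the sum of the gamma_v v is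
  integral in all coordinates from I Un J and the remaining coefficients nu - gamma have total sum
  less than d: for coefficients in (1/p) Z with a prime p this is Olson's theorem that every sequence
  of d (p - 1) + 1 vectors over Z/p of dimension d has a nonempty zero-sum subsequence, and the
  general case follows by approximation. Now z = w + sum (nu_v - gamma_v) v is feasible for (J-MIP),
  w' = w + sum gamma_v v is feasible for (I-MIP), and z + w' = z0 + w. Since w' is not better than w,
  z is not worse than z0.
*)
theory Submission
  imports
    Defs
    "HOL-Computational_Algebra.Primes"
    "HOL-Analysis.Function_Topology"
begin

section \<open>Zero-sum subsequences\<close>

text \<open>Each monomial of the expanded product involves at most \<open>card \<Lambda>\<close>
  elements of \<open>X\<close>. Together with those of \<open>T\<close> they leave some element of
  \<open>X\<close> free, and toggling that element flips the sign. Supersets of an arbitrary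
  \<open>T\<close> are considered because splitting off a factor prescribes one more
  element.\<close>

lemma alternating_sum_prod_affine:
  fixes a :: "'l \<Rightarrow> 'a \<Rightarrow> int" and c :: "'l \<Rightarrow> int"
  assumes "finite \<Lambda>" "finite X" "T \<subseteq> X" "card \<Lambda> + card T < card X"
  shows "(\<Sum>S | T \<subseteq> S \<and> S \<subseteq> X. (-1) ^ card S * (\<Prod>l\<in>\<Lambda>. c l + (\<Sum>j\<in>S. a l j))) = 0"
  using assms
proof (induction \<Lambda> arbitrary: T rule: finite_induct)
  case empty
  then have "T \<subset> X" by auto
  then have "(\<Sum>S | S \<subseteq> X \<and> T \<subseteq> S. (-1::int) ^ card S) = 0"
    using card_subsupersets_even_odd[of X T] empty.prems(1)
    by (intro sum_alternating_cancels) (auto simp: conj_assoc)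
  then show ?case by (simp add: conj_commute)
next
  case (insert l \<Lambda>)
  define P where "P S = (-1) ^ card S * (\<Prod>l\<in>\<Lambda>. c l + (\<Sum>j\<in>S. a l j))" for S
  have fin: "finite {S. U \<subseteq> S \<and> S \<subseteq> X}" for U
    using insert.prems(1) by (rule_tac finite_subset[of _ "Pow X"]) auto
  \<comment> \<open>The induction hypothesis applies: one factor has been removed and at most one
    element is added to \<open>T\<close>.\<close>
  have zero: "(\<Sum>S | insert j T \<subseteq> S \<and> S \<subseteq> X. P S) = 0" if "j \<in> X" for j
  proof -
    have "finite T" using insert.prems(1,2) by (rule rev_finite_subset)
    then show ?thesis
      unfolding P_def using insert that by (intro insert.IH) (auto simp: card_insert_if)
  qed
  have "(\<Sum>S | T \<subseteq> S \<and> S \<subseteq> X. (\<Sum>j\<in>S. a l j) * P S) =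
        (\<Sum>S | T \<subseteq> S \<and> S \<subseteq> X. \<Sum>j\<in>X. if j \<in> S then a l j * P S else 0)"
  proof (intro sum.cong refl)
    fix S assume "S \<in> {S. T \<subseteq> S \<and> S \<subseteq> X}"
    then have "X \<inter> S = S" by auto
    then show "(\<Sum>j\<in>S. a l j) * P S = (\<Sum>j\<in>X. if j \<in> S then a l j * P S else 0)"
      using insert.prems(1) by (simp add: sum.inter_restrict[symmetric] sum_distrib_right)
  qed
  also have "\<dots> = (\<Sum>j\<in>X. \<Sum>S | T \<subseteq> S \<and> S \<subseteq> X. if j \<in> S then a l j * P S else 0)"
    by (rule sum.swap)
  also have "\<dots> = (\<Sum>j\<in>X. a l j * (\<Sum>S | insert j T \<subseteq> S \<and> S \<subseteq> X. P S))"
  proof (intro sum.cong refl)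
    fix j
    have "{S. insert j T \<subseteq> S \<and> S \<subseteq> X} = {S. T \<subseteq> S \<and> S \<subseteq> X} \<inter> {S. j \<in> S}" by auto
    then show "(\<Sum>S | T \<subseteq> S \<and> S \<subseteq> X. if j \<in> S then a l j * P S else 0) =
        a l j * (\<Sum>S | insert j T \<subseteq> S \<and> S \<subseteq> X. P S)"
      using fin by (simp add: sum_distrib_left sum.inter_restrict if_distrib cong: if_cong)
  qed
  also have "\<dots> = 0" using zero by simp
  finally have "(\<Sum>S | T \<subseteq> S \<and> S \<subseteq> X. (\<Sum>j\<in>S. a l j) * P S) = 0" .
  moreover have "(\<Sum>S | T \<subseteq> S \<and> S \<subseteq> X. P S) = 0"
    unfolding P_def using insert by (intro insert.IH) auto
  ultimately have "(\<Sum>S | T \<subseteq> S \<and> S \<subseteq> X. c l * P S + (\<Sum>j\<in>S. a l j) * P S) = 0"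
    by (simp add: sum.distrib flip: sum_distrib_left)
  then show ?case
    using insert.hyps by (simp add: P_def algebra_simps)
qed

text \<open>Olson's value of the Davenport constant of \<open>(\<int>/p)\<^sup>K\<close>. The product of the shifted forms \<open>L\<^sub>k - i\<close>,
  \<open>0 < i < p\<close>, has too low a degree for its alternating sum over all subsets not to vanish, but modulo
  \<open>p\<close> only zero-sum subsets contribute to that sum.\<close>

lemma zero_sum_subset_mod_prime:
  fixes g :: "'a \<Rightarrow> 'k \<Rightarrow> int" and p :: nat
  assumes p: "prime p" and "finite K" "finite X" "card K * (p - 1) < card X"
  shows "\<exists>S\<subseteq>X. S \<noteq> {} \<and> (\<forall>k\<in>K. int p dvd (\<Sum>j\<in>S. g j k))"
proof (rule ccontr)
  assume no: "\<not> ?thesis"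
  define F where "F S = (\<Prod>l\<in>K \<times> {0<..<p}. - int (snd l) + (\<Sum>j\<in>S. g j (fst l)))" for S
  have p': "prime (int p)" using p by simp
  have "int p dvd F S" if S: "S \<subseteq> X" "S \<noteq> {}" for S
  proof -
    obtain k where k: "k \<in> K" "\<not> int p dvd (\<Sum>j\<in>S. g j k)" using no S by blast
    \<comment> \<open>\<open>i\<close> is the residue of a form that does not vanish modulo
      \<open>p\<close>, so the factor of \<open>F S\<close> with index \<open>(k, i)\<close> is
      divisible by \<open>p\<close>.\<close>
    define i where "i = nat ((\<Sum>j\<in>S. g j k) mod int p)"
    have i: "int i = (\<Sum>j\<in>S. g j k) mod int p" "i \<in> {0<..<p}"
      using k(2) pos_mod_sign[of "int p" "\<Sum>j\<in>S. g j k"] pos_mod_bound[of "int p" "\<Sum>j\<in>S. g j k"]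
        prime_gt_0_nat[OF p]
      unfolding i_def dvd_eq_mod_eq_0 greaterThanLessThan_iff by linarith+
    have "int p dvd - int i + (\<Sum>j\<in>S. g j k)"
      using i(1) by (simp add: minus_mod_eq_mult_div)
    moreover have "(- int i + (\<Sum>j\<in>S. g j k)) dvd F S"
      unfolding F_def using k i assms by (intro dvd_trans[OF _ dvd_prodI[of _ "(k, i)"]]) auto
    ultimately show ?thesis by (rule dvd_trans)
  qed
  moreover have "(\<Sum>S\<in>Pow X. (-1) ^ card S * F S) = 0"
    using alternating_sum_prod_affine[of "K \<times> {0<..<p}" X "{}" "\<lambda>l. - int (snd l)" "\<lambda>l j. g j (fst l)"] assms
    by (simp add: F_def Pow_def card_cartesian_product)
  moreover have "(\<Sum>S\<in>Pow X. (-1) ^ card S * F S) = F {} + (\<Sum>S\<in>Pow X - {{}}. (-1) ^ card S * F S)"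
    using assms by (subst sum.remove[of _ "{}"]) auto
  ultimately have "int p dvd F {}"
    by (metis (no_types, lifting) DiffD1 DiffD2 Pow_iff dvd_0_right dvd_add_left_iff dvd_mult dvd_sum singletonI)
  \<comment> \<open>\<open>F {}\<close> is a product of numbers \<open>- i\<close> with
    \<open>0 < i < p\<close>.\<close>
  then obtain l where "l \<in> K \<times> {0<..<p}" "int p dvd - int (snd l)"
    unfolding F_def using p' assms by (auto simp: prime_dvd_prod_iff)
  then show False by (auto dest: dvd_imp_le)
qed

text \<open>The sequence in which \<open>u i\<close> is repeated \<open>m i\<close> times, modelled
  by the pairs in \<open>?X\<close>, has a zero-sum subsequence; \<open>j i\<close> counts the
  copies of \<open>u i\<close> in it.\<close>

lemma zero_sum_multiplicities_mod_prime:
  fixes u :: "'i \<Rightarrow> 'k \<Rightarrow> int" and m :: "'i \<Rightarrow> nat"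
  assumes "prime p" "finite K" "finite V" "card K * (p - 1) < (\<Sum>i\<in>V. m i)"
  shows "\<exists>j. (\<forall>i\<in>V. j i \<le> m i) \<and> (\<exists>i\<in>V. j i \<noteq> 0) \<and> (\<forall>k\<in>K. int p dvd (\<Sum>i\<in>V. int (j i) * u i k))"
proof -
  let ?X = "SIGMA i:V. {..<m i}"
  have "card ?X = (\<Sum>i\<in>V. m i)" using assms by simp
  then obtain S where S: "S \<subseteq> ?X" "S \<noteq> {}" "\<forall>k\<in>K. int p dvd (\<Sum>x\<in>S. u (fst x) k)"
    using zero_sum_subset_mod_prime[of p K ?X "\<lambda>x. u (fst x)"] assms by auto
  have finS: "finite S" using S(1) assms(3) by (rule_tac finite_subset) auto
  define j where "j i = card {x \<in> S. fst x = i}" for i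
  have "j i \<le> m i" if "i \<in> V" for i
  proof -
    have "j i \<le> card (Pair i ` {..<m i})"
      unfolding j_def using S(1) by (intro card_mono) auto
    also have "\<dots> \<le> m i" using card_image_le[of "{..<m i}" "Pair i"] by simp
    finally show ?thesis .
  qed
  moreover have "\<exists>i\<in>V. j i \<noteq> 0"
  proof -
    obtain x where "x \<in> S" using S(2) by auto
    then have "(fst x, snd x) \<in> S" by simp
    then have "j (fst x) \<noteq> 0" using finS unfolding j_def by (auto simp del: prod.collapse)
    moreover have "fst x \<in> V" using \<open>x \<in> S\<close> S(1) by auto
    ultimately show ?thesis by auto
  qed
  moreover have "(\<Sum>x\<in>S. u (fst x) k) = (\<Sum>i\<in>V. int (j i) * u i k)" for k
  proof -
    have "fst ` S \<subseteq> V" using S(1) by auto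
    then have "(\<Sum>x\<in>S. u (fst x) k) = (\<Sum>i\<in>V. \<Sum>x | x \<in> S \<and> fst x = i. u (fst x) k)"
      by (intro sum.group[symmetric] finS assms(3))
    also have "\<dots> = (\<Sum>i\<in>V. int (j i) * u i k)"
      by (intro sum.cong) (auto simp: j_def)
    finally show ?thesis .
  qed
  ultimately show ?thesis using S(3) by auto
qed

section \<open>Integral combinations with small residual\<close>

text \<open>Rounding \<open>\<alpha>\<close> down to multiples of \<open>1/p\<close> for a large
  prime \<open>p\<close> costs so little total weight that the result on multiplicities modulo
  \<open>p\<close> applies. The multiplicities \<open>j i\<close> become coefficients
  \<open>j i / p\<close>, and divisibility by \<open>p\<close> becomes integrality.\<close>

lemma integral_combination_strict:
  fixes u :: "'i \<Rightarrow> 'k \<Rightarrow> int" and \<alpha> :: "'i \<Rightarrow> real"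
  assumes K: "finite K" and V: "finite V" and \<alpha>: "\<And>i. i \<in> V \<Longrightarrow> 0 \<le> \<alpha> i"
    and sum: "real (card K) < (\<Sum>i\<in>V. \<alpha> i)"
  shows "\<exists>\<beta>. (\<forall>i\<in>V. 0 \<le> \<beta> i \<and> \<beta> i \<le> \<alpha> i) \<and> (\<exists>i\<in>V. \<beta> i \<noteq> 0) \<and>
             (\<forall>k\<in>K. (\<Sum>i\<in>V. \<beta> i * u i k) \<in> \<int>)"
proof -
  define \<delta> where "\<delta> = (\<Sum>i\<in>V. \<alpha> i) - card K"
  have "\<delta> > 0" using sum by (simp add: \<delta>_def)
  \<comment> \<open>Rounding the numbers \<open>p * \<alpha> i\<close> down loses at most
    \<open>card V\<close> altogether, which is to be less than the scaled surplus
    \<open>p * \<delta>\<close>.\<close>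
  obtain p where p: "prime p" "nat \<lceil>card V / \<delta>\<rceil> < p" using bigger_prime by blast
  then have "card V / \<delta> < p" by linarith
  then have p\<delta>: "card V < p * \<delta>" using \<open>\<delta> > 0\<close> by (simp add: field_simps)
  have p0: "p > 0" using p(1) by (rule prime_gt_0_nat)
  define m where "m i = nat \<lfloor>p * \<alpha> i\<rfloor>" for i
  have m: "real (m i) \<le> p * \<alpha> i" "p * \<alpha> i - 1 \<le> real (m i)" if "i \<in> V" for i
  proof -
    have "0 \<le> p * \<alpha> i" using \<alpha>[OF that] by simp
    then show "real (m i) \<le> p * \<alpha> i" "p * \<alpha> i - 1 \<le> real (m i)" unfolding m_def by linarith+
  qed
  have "real (card K * (p - 1)) \<le> p * card K"
    by (metis diff_le_self mult.commute mult_le_mono1 of_nat_le_iff of_nat_mult)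
  also have "\<dots> < p * (\<Sum>i\<in>V. \<alpha> i) - card V"
    using p\<delta> by (simp add: \<delta>_def algebra_simps)
  also have "\<dots> = (\<Sum>i\<in>V. p * \<alpha> i - 1)" by (simp add: sum_subtractf sum_distrib_left)
  also have "\<dots> \<le> (\<Sum>i\<in>V. real (m i))" using m by (intro sum_mono)
  finally have "card K * (p - 1) < (\<Sum>i\<in>V. m i)"
    unfolding of_nat_sum[symmetric] of_nat_less_iff .
  then obtain j where j: "\<forall>i\<in>V. j i \<le> m i" "\<exists>i\<in>V. j i \<noteq> 0"
    "\<forall>k\<in>K. int p dvd (\<Sum>i\<in>V. int (j i) * u i k)"
    using zero_sum_multiplicities_mod_prime[OF p(1) K V, of m u] by blast
  show ?thesis
  proof (intro exI[of _ "\<lambda>i. real (j i) / p"] conjI ballI)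
    show "real (j i) / p \<le> \<alpha> i" if "i \<in> V" for i
    proof -
      have "real (j i) \<le> real (m i)" using j(1) that by simp
      also have "\<dots> \<le> p * \<alpha> i" using m that by simp
      finally show ?thesis using p0 by (simp add: field_simps)
    qed
    show "\<exists>i\<in>V. real (j i) / p \<noteq> 0" using j(2) p0 by auto
    show "(\<Sum>i\<in>V. real (j i) / p * u i k) \<in> \<int>" if "k \<in> K" for k
    proof -
      obtain q where q: "(\<Sum>i\<in>V. int (j i) * u i k) = int p * q" using j(3) \<open>k \<in> K\<close> by blast
      have "(\<Sum>i\<in>V. real (j i) / p * u i k) = real_of_int (\<Sum>i\<in>V. int (j i) * u i k) / p"
        by (simp add: sum_divide_distrib)
      also have "\<dots> = q" using q p0 by simp
      finally show ?thesis by simp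
    qed
  qed auto
qed

lemma closed_Ints_real: "closed (\<int> :: real set)"
proof -
  have "- (\<int> :: real set) = (\<Union>n::int. {of_int n<..<of_int n + 1})"
  proof (intro equalityI subsetI)
    fix x :: real assume "x \<in> - \<int>"
    then have "x \<noteq> of_int \<lfloor>x\<rfloor>" by (metis ComplD Ints_of_int)
    then have "x \<in> {of_int \<lfloor>x\<rfloor><..<of_int \<lfloor>x\<rfloor> + 1}"
      using of_int_floor_le[of x] real_of_int_floor_add_one_gt[of x]
      unfolding greaterThanLessThan_iff by linarith
    then show "x \<in> (\<Union>n::int. {of_int n<..<of_int n + 1})" by blast
  next
    fix x :: real assume "x \<in> (\<Union>n::int. {of_int n<..<of_int n + 1})"
    then obtain n :: int where "of_int n < x" "x < of_int n + 1" by auto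
    then have "x \<noteq> of_int k" for k by auto
    then show "x \<in> - \<int>" by (auto elim!: Ints_cases)
  qed
  then show ?thesis by (simp add: closed_def open_UN)
qed

text \<open>A closed subset of a product of compact intervals is compact by Tychonoff's theorem.
  Coordinates outside \<open>V\<close> are pinned to \<open>0\<close> to make every factor
  compact.\<close>

lemma compact_integral_combinations:
  fixes u :: "'i \<Rightarrow> 'k \<Rightarrow> int" and \<alpha> :: "'i \<Rightarrow> real"
  shows "compact {\<beta>. (\<forall>i\<in>V. 0 \<le> \<beta> i \<and> \<beta> i \<le> \<alpha> i) \<and> (\<forall>i. i \<notin> V \<longrightarrow> \<beta> i = 0) \<and>
                    (\<forall>k\<in>K. (\<Sum>i\<in>V. \<beta> i * u i k) \<in> \<int>)}" (is "compact ?B")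
proof -
  let ?P = "PiE UNIV (\<lambda>i. if i \<in> V then {0..\<alpha> i} else {0})"
  let ?C = "\<Inter>k\<in>K. (\<lambda>\<beta>. \<Sum>i\<in>V. \<beta> i * real_of_int (u i k)) -` \<int>"
  have "compactin (product_topology (\<lambda>i. euclidean) UNIV) ?P"
    by (subst compactin_PiE) auto
  then have "compact ?P" by (simp add: euclidean_product_topology)
  moreover have "closed ?C"
    by (intro closed_INT ballI closed_vimage continuous_intros closed_Ints_real
        continuous_on_product_coordinates)
  moreover have "?B = ?P \<inter> ?C" by (auto simp: PiE_iff split: if_splits)
  ultimately show ?thesis by (simp add: compact_Int_closed)
qed

text \<open>In the boundary case \<open>\<Sum>\<alpha> = card K\<close>, solutions for the slightly enlarged boxes \<open>(1 + \<epsilon>) \<alpha>\<close>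
  accumulate at a solution for the box \<open>\<alpha>\<close>. The accumulation point is not \<open>0\<close>, since the
  integral vectors \<open>\<Sum>\<beta>u\<close> may be assumed to be nonzero: if \<open>\<Sum>\<beta>u = 0\<close>, then \<open>\<beta>\<close> can be scaled down.\<close>

lemma integral_combination:
  fixes u :: "'i \<Rightarrow> 'k \<Rightarrow> int" and \<alpha> :: "'i \<Rightarrow> real"
  assumes K: "finite K" "K \<noteq> {}" and V: "finite V" and \<alpha>: "\<And>i. i \<in> V \<Longrightarrow> 0 \<le> \<alpha> i"
    and sum: "real (card K) \<le> (\<Sum>i\<in>V. \<alpha> i)"
  shows "\<exists>\<beta>. (\<forall>i\<in>V. 0 \<le> \<beta> i \<and> \<beta> i \<le> \<alpha> i) \<and> (\<exists>i\<in>V. \<beta> i \<noteq> 0) \<and>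
             (\<forall>k\<in>K. (\<Sum>i\<in>V. \<beta> i * u i k) \<in> \<int>)"
proof (rule ccontr)
  assume no: "\<not> ?thesis"
  define \<sigma> where "\<sigma> = (\<Sum>i\<in>V. \<alpha> i)"
  have "\<sigma> > 0" using sum K by (simp add: \<sigma>_def card_gt_0_iff less_le_trans[of 0 "real (card K)"])
  define N where "N \<beta> = (\<Sum>k\<in>K. \<bar>\<Sum>i\<in>V. \<beta> i * real_of_int (u i k)\<bar>)" for \<beta>
  \<comment> \<open>\<open>h\<close> measures how far \<open>\<beta>\<close> exceeds the box
    \<open>\<alpha>\<close>; it vanishes exactly inside the box.\<close>
  define h where "h \<beta> = (\<Sum>i\<in>V. max 0 (\<beta> i - \<alpha> i))" for \<beta>
  \<comment> \<open>The bound \<open>2 * \<alpha> i\<close> covers all enlarged boxes with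
    \<open>\<epsilon> \<le> 1\<close>, and \<open>1 \<le> N \<beta>\<close> is a closed condition
    that excludes \<open>\<beta> = 0\<close>.\<close>
  define B where "B = {\<beta>. (\<forall>i\<in>V. 0 \<le> \<beta> i \<and> \<beta> i \<le> 2 * \<alpha> i) \<and> (\<forall>i. i \<notin> V \<longrightarrow> \<beta> i = 0) \<and>
                    (\<forall>k\<in>K. (\<Sum>i\<in>V. \<beta> i * u i k) \<in> \<int>)} \<inter> {\<beta>. 1 \<le> N \<beta>}"
  have "compact B"
    unfolding B_def N_def
    by (intro compact_Int_closed compact_integral_combinations closed_Collect_le continuous_intros
        continuous_on_product_coordinates)
  have approx: "\<exists>\<beta>\<in>B. h \<beta> \<le> \<epsilon> * \<sigma>" if \<epsilon>: "0 < \<epsilon>" "\<epsilon> \<le> 1" for \<epsilon>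
  proof -
    have "real (card K) < (\<Sum>i\<in>V. (1 + \<epsilon>) * \<alpha> i)"
      using sum \<epsilon> \<open>\<sigma> > 0\<close> unfolding sum_distrib_left[symmetric] \<sigma>_def
      by (simp add: distrib_right add_strict_increasing2 le_less_trans)
    then obtain \<beta> where \<beta>: "\<forall>i\<in>V. 0 \<le> \<beta> i \<and> \<beta> i \<le> (1 + \<epsilon>) * \<alpha> i" "\<exists>i\<in>V. \<beta> i \<noteq> 0"
      "\<forall>k\<in>K. (\<Sum>i\<in>V. \<beta> i * u i k) \<in> \<int>"
      using integral_combination_strict[OF K(1) V, of "\<lambda>i. (1 + \<epsilon>) * \<alpha> i" u] \<alpha> \<epsilon> by auto
    have "\<exists>k\<in>K. (\<Sum>i\<in>V. \<beta> i * u i k) \<noteq> 0"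
    proof (rule ccontr)
      assume "\<not> ?thesis"
      moreover define \<gamma> where "\<gamma> i = \<beta> i / (1 + \<epsilon>)" for i
      have "(\<Sum>i\<in>V. \<gamma> i * u i k) = (\<Sum>i\<in>V. \<beta> i * u i k) / (1 + \<epsilon>)" for k
        by (simp add: \<gamma>_def sum_divide_distrib)
      ultimately have "\<forall>k\<in>K. (\<Sum>i\<in>V. \<gamma> i * u i k) \<in> \<int>" by simp
      moreover have "\<forall>i\<in>V. 0 \<le> \<gamma> i \<and> \<gamma> i \<le> \<alpha> i"
        using \<beta>(1) \<epsilon> by (simp add: \<gamma>_def pos_divide_le_eq mult.commute)
      moreover have "\<exists>i\<in>V. \<gamma> i \<noteq> 0" using \<beta>(2) \<epsilon> by (simp add: \<gamma>_def)
      ultimately have "\<exists>\<beta>. (\<forall>i\<in>V. 0 \<le> \<beta> i \<and> \<beta> i \<le> \<alpha> i) \<and> (\<exists>i\<in>V. \<beta> i \<noteq> 0) \<and>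
             (\<forall>k\<in>K. (\<Sum>i\<in>V. \<beta> i * u i k) \<in> \<int>)" by (intro exI[of _ \<gamma>] conjI)
      with no show False ..
    qed
    then obtain k where k: "k \<in> K" "(\<Sum>i\<in>V. \<beta> i * u i k) \<noteq> 0" by blast
    then have "1 \<le> \<bar>\<Sum>i\<in>V. \<beta> i * u i k\<bar>" using \<beta>(3) Ints_nonzero_abs_ge1 by blast
    also have "\<dots> \<le> N \<beta>" unfolding N_def
      using k K by (intro member_le_sum[of k K "\<lambda>k. \<bar>\<Sum>i\<in>V. \<beta> i * u i k\<bar>"]) auto
    finally have "1 \<le> N \<beta>" .
    define \<beta>' where "\<beta>' i = (if i \<in> V then \<beta> i else 0)" for i
    have "\<beta>' \<in> B"
    proof -
      have "\<beta> i \<le> 2 * \<alpha> i" if "i \<in> V" for i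
      proof -
        have "\<beta> i \<le> (1 + \<epsilon>) * \<alpha> i" using \<beta>(1) that by blast
        also have "\<dots> \<le> 2 * \<alpha> i" using \<epsilon> \<alpha>[OF that] by (intro mult_right_mono) auto
        finally show ?thesis .
      qed
      moreover have "N \<beta>' = N \<beta>" by (simp add: N_def \<beta>'_def)
      ultimately show ?thesis using \<beta> \<open>1 \<le> N \<beta>\<close> by (auto simp: B_def \<beta>'_def)
    qed
    moreover have "h \<beta>' \<le> (\<Sum>i\<in>V. \<epsilon> * \<alpha> i)"
      unfolding h_def using \<beta>(1) \<alpha> \<epsilon> by (intro sum_mono) (auto simp: \<beta>'_def algebra_simps)
    ultimately show ?thesis by (auto simp: \<sigma>_def sum_distrib_left)
  qed
  moreover have "continuous_on B h"
    unfolding h_def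
    by (intro continuous_intros continuous_on_subset[OF continuous_on_product_coordinates subset_UNIV])
  \<comment> \<open>A minimum point of \<open>h\<close> on the compact set \<open>B\<close> serves
    as the accumulation point.\<close>
  ultimately obtain \<beta> where \<beta>: "\<beta> \<in> B" "\<And>\<gamma>. \<gamma> \<in> B \<Longrightarrow> h \<beta> \<le> h \<gamma>"
    using continuous_attains_inf[OF \<open>compact B\<close>, of h] approx[of 1] by fastforce
  have "h \<beta> \<le> 0"
  proof (rule ccontr)
    assume "\<not> h \<beta> \<le> 0"
    define \<epsilon> where "\<epsilon> = min 1 (h \<beta> / (2 * \<sigma>))"
    have "0 < \<epsilon>" "\<epsilon> \<le> 1" using \<open>\<sigma> > 0\<close> \<open>\<not> h \<beta> \<le> 0\<close> by (auto simp: \<epsilon>_def)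
    then obtain \<gamma> where "\<gamma> \<in> B" "h \<gamma> \<le> \<epsilon> * \<sigma>" using approx by blast
    moreover have "\<epsilon> * \<sigma> \<le> h \<beta> / (2 * \<sigma>) * \<sigma>"
      using \<open>\<sigma> > 0\<close> by (intro mult_right_mono) (auto simp: \<epsilon>_def)
    ultimately show False using \<beta>(2)[of \<gamma>] \<open>\<sigma> > 0\<close> \<open>\<not> h \<beta> \<le> 0\<close> by simp
  qed
  have "\<beta> i \<le> \<alpha> i" if "i \<in> V" for i
  proof -
    have "max 0 (\<beta> i - \<alpha> i) \<le> h \<beta>"
      unfolding h_def using that V by (intro member_le_sum[of i V "\<lambda>i. max 0 (\<beta> i - \<alpha> i)"]) auto
    then show ?thesis using \<open>h \<beta> \<le> 0\<close> by auto
  qed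
  moreover have "\<exists>i\<in>V. \<beta> i \<noteq> 0"
  proof (rule ccontr)
    assume "\<not> ?thesis"
    then have "N \<beta> = 0" by (simp add: N_def)
    then show False using \<beta>(1) by (simp add: B_def)
  qed
  moreover have "\<forall>i\<in>V. 0 \<le> \<beta> i" "\<forall>k\<in>K. (\<Sum>i\<in>V. \<beta> i * u i k) \<in> \<int>"
    using \<beta>(1) by (simp_all add: B_def)
  ultimately have "\<exists>\<beta>. (\<forall>i\<in>V. 0 \<le> \<beta> i \<and> \<beta> i \<le> \<alpha> i) \<and> (\<exists>i\<in>V. \<beta> i \<noteq> 0) \<and>
             (\<forall>k\<in>K. (\<Sum>i\<in>V. \<beta> i * u i k) \<in> \<int>)" by (intro exI[of _ \<beta>] conjI ballI) simp_all
  with no show False ..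
qed

text \<open>Take an admissible \<open>\<gamma>\<close> of maximal total weight, which exists by
  compactness. A residual of weight at least \<open>card K\<close> would contain a further nonzero
  integral combination, and adding it to \<open>\<gamma>\<close> would increase the weight.\<close>

lemma integral_combination_residual:
  fixes u :: "'i \<Rightarrow> 'k \<Rightarrow> int" and \<alpha> :: "'i \<Rightarrow> real"
  assumes K: "finite K" "K \<noteq> {}" and V: "finite V" and \<alpha>: "\<And>i. i \<in> V \<Longrightarrow> 0 \<le> \<alpha> i"
  obtains \<gamma> where "\<forall>i\<in>V. 0 \<le> \<gamma> i \<and> \<gamma> i \<le> \<alpha> i" "\<forall>k\<in>K. (\<Sum>i\<in>V. \<gamma> i * u i k) \<in> \<int>"
    "(\<Sum>i\<in>V. \<alpha> i - \<gamma> i) < card K"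
proof -
  define B where "B = {\<beta>. (\<forall>i\<in>V. 0 \<le> \<beta> i \<and> \<beta> i \<le> \<alpha> i) \<and> (\<forall>i. i \<notin> V \<longrightarrow> \<beta> i = 0) \<and>
                    (\<forall>k\<in>K. (\<Sum>i\<in>V. \<beta> i * u i k) \<in> \<int>)}"
  have "compact B" unfolding B_def by (rule compact_integral_combinations)
  moreover have "(\<lambda>i. 0) \<in> B" using \<alpha> by (simp add: B_def)
  moreover have "continuous_on B (\<lambda>\<beta>. \<Sum>i\<in>V. \<beta> i)"
    by (intro continuous_intros continuous_on_subset[OF continuous_on_product_coordinates subset_UNIV])
  ultimately obtain \<gamma> where \<gamma>: "\<gamma> \<in> B" "\<And>\<beta>. \<beta> \<in> B \<Longrightarrow> (\<Sum>i\<in>V. \<beta> i) \<le> (\<Sum>i\<in>V. \<gamma> i)"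
    using continuous_attains_sup[of B "\<lambda>\<beta>. \<Sum>i\<in>V. \<beta> i"] by blast
  have "(\<Sum>i\<in>V. \<alpha> i - \<gamma> i) < card K"
  proof (rule ccontr)
    assume "\<not> ?thesis"
    then obtain \<beta> where \<beta>: "\<forall>i\<in>V. 0 \<le> \<beta> i \<and> \<beta> i \<le> \<alpha> i - \<gamma> i" "\<exists>i\<in>V. \<beta> i \<noteq> 0"
      "\<forall>k\<in>K. (\<Sum>i\<in>V. \<beta> i * u i k) \<in> \<int>"
      using integral_combination[OF K V, of "\<lambda>i. \<alpha> i - \<gamma> i" u] \<gamma>(1) by (auto simp: B_def)
    have "(\<lambda>i. if i \<in> V then \<gamma> i + \<beta> i else 0) \<in> B"
      using \<gamma>(1) \<beta>(1,3) by (force simp: B_def distrib_right sum.distrib)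
    from \<gamma>(2)[OF this] have "(\<Sum>i\<in>V. \<beta> i) \<le> 0" by (simp add: sum.distrib)
    then have "\<forall>i\<in>V. \<beta> i = 0"
      using V \<beta>(1) by (metis (no_types, lifting) order_antisym sum_nonneg sum_nonneg_eq_0_iff)
    then show False using \<beta>(2) by blast
  qed
  then show ?thesis using \<gamma>(1) by (intro that[of \<gamma>]) (simp_all add: B_def)
qed

section \<open>Conformal decompositions\<close>

text \<open>Sign compatibility: \<open>x\<close> may vanish where \<open>y\<close> does not, but a
  zero of \<open>y\<close> forces a zero of \<open>x\<close>.\<close>

definition conformal :: "'q set \<Rightarrow> ('q \<Rightarrow> real) \<Rightarrow> ('q \<Rightarrow> real) \<Rightarrow> bool" where
  "conformal Q x y \<longleftrightarrow> (\<forall>q\<in>Q. (0 < x q \<longrightarrow> 0 < y q) \<and> (x q < 0 \<longrightarrow> y q < 0))"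

lemma conformal_trans: "conformal Q x y \<Longrightarrow> conformal Q y z \<Longrightarrow> conformal Q x z"
  by (auto simp: conformal_def)

text \<open>Move from \<open>y\<close> in direction \<open>- x\<close> until the first coordinate
  becomes zero. Only the coordinates in \<open>P\<close>, where \<open>x\<close> and
  \<open>y\<close> have the same sign, approach zero; \<open>t\<close> is the least ratio among
  them.\<close>

lemma conformal_reduce_support:
  fixes x y :: "'q \<Rightarrow> real"
  assumes Q: "finite Q" and supp: "\<And>q. q \<in> Q \<Longrightarrow> y q = 0 \<Longrightarrow> x q = 0"
    and q0: "q0 \<in> Q" "0 < x q0 * y q0"
  shows "\<exists>t>0. conformal Q (\<lambda>q. y q - t * x q) y \<and>
               card {q\<in>Q. y q - t * x q \<noteq> 0} < card {q\<in>Q. y q \<noteq> 0}"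
proof -
  define P where "P = {q\<in>Q. 0 < x q * y q}"
  define t where "t = Min ((\<lambda>q. y q / x q) ` P)"
  have P: "finite P" "P \<noteq> {}" using Q q0 by (auto simp: P_def)
  then have "t \<in> (\<lambda>q. y q / x q) ` P" unfolding t_def by (intro Min_in) auto
  then obtain q1 where q1: "q1 \<in> P" "t = y q1 / x q1" by blast
  have "t > 0" using q1 by (auto simp: P_def zero_less_mult_iff zero_less_divide_iff)
  have le: "t \<le> y q / x q" if "q \<in> P" for q using that P by (simp add: t_def)
  have "conformal Q (\<lambda>q. y q - t * x q) y"
    unfolding conformal_def
  proof (intro ballI)
    fix q assume q: "q \<in> Q"
    consider "0 < x q" "0 < y q" | "x q < 0" "y q < 0" | "x q * y q \<le> 0"
      by (meson not_less zero_less_mult_iff)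
    then show "(0 < y q - t * x q \<longrightarrow> 0 < y q) \<and> (y q - t * x q < 0 \<longrightarrow> y q < 0)"
    proof cases
      case 1
      then have "t * x q \<le> y q" using le[of q] q by (simp add: P_def field_simps)
      then show ?thesis using 1 by simp
    next
      case 2
      then have "y q \<le> t * x q" using le[of q] q by (simp add: P_def field_simps mult_neg_neg)
      then show ?thesis using 2 by simp
    next
      case 3
      then consider "x q \<le> 0" "0 < y q" | "0 \<le> x q" "y q < 0" | "x q = 0" "y q = 0"
        using supp[OF q] by (fastforce simp: mult_le_0_iff)
      then show ?thesis
        using \<open>t > 0\<close> mult_nonneg_nonneg[of t "x q"] mult_nonneg_nonpos[of t "x q"]
        by cases linarith+
    qed
  qed
  moreover have "{q\<in>Q. y q - t * x q \<noteq> 0} \<subset> {q\<in>Q. y q \<noteq> 0}"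
  proof
    show "{q\<in>Q. y q - t * x q \<noteq> 0} \<subseteq> {q\<in>Q. y q \<noteq> 0}" using supp by auto
    have "q1 \<in> {q\<in>Q. y q \<noteq> 0} - {q\<in>Q. y q - t * x q \<noteq> 0}" using q1 by (auto simp: P_def)
    then show "{q\<in>Q. y q - t * x q \<noteq> 0} \<noteq> {q\<in>Q. y q \<noteq> 0}" by blast
  qed
  then have "card {q\<in>Q. y q - t * x q \<noteq> 0} < card {q\<in>Q. y q \<noteq> 0}"
    using Q by (intro psubset_card_mono) auto
  ultimately show ?thesis using \<open>t > 0\<close> by blast
qed

text \<open>Induction on the size of the support of \<open>y\<close>. From \<open>y\<close>, walk
  along some \<open>\<phi> x\<close> supported within \<open>y\<close> in both directions until a
  coordinate vanishes. Then \<open>y\<close> is a convex combination of the two end points, which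
  have smaller support and are conformal to \<open>y\<close>. If \<open>\<phi> x\<close> is itself
  conformal to \<open>y\<close>, one direction suffices and \<open>\<phi> x\<close> is added
  back.\<close>

lemma conformal_decomposition:
  fixes U :: "('q \<Rightarrow> real) set" and W :: "'w set" and \<phi> :: "'w \<Rightarrow> 'q \<Rightarrow> real"
  assumes Q: "finite Q" and W: "finite W" and WU: "\<phi> ` W \<subseteq> U"
    and U: "\<And>y x t. y \<in> U \<Longrightarrow> x \<in> U \<Longrightarrow> (\<lambda>q. y q - t * x q) \<in> U"
    and W_uminus: "\<And>x. x \<in> W \<Longrightarrow> \<exists>x'\<in>W. \<phi> x' = (\<lambda>q. - \<phi> x q)"
    and ex: "\<And>y. y \<in> U \<Longrightarrow> \<exists>q\<in>Q. y q \<noteq> 0 \<Longrightarrow>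
               \<exists>x\<in>W. (\<exists>q\<in>Q. \<phi> x q \<noteq> 0) \<and> (\<forall>q\<in>Q. y q = 0 \<longrightarrow> \<phi> x q = 0)"
    and "y \<in> U"
  shows "\<exists>\<nu>::'w \<Rightarrow> real. (\<forall>v\<in>W. 0 \<le> \<nu> v \<and> (\<nu> v \<noteq> 0 \<longrightarrow> conformal Q (\<phi> v) y)) \<and>
             (\<forall>q\<in>Q. y q = (\<Sum>v\<in>W. \<nu> v * \<phi> v q))"
  using \<open>y \<in> U\<close>
proof (induction "card {q\<in>Q. y q \<noteq> 0}" arbitrary: y rule: less_induct)
  case less
  show ?case
  proof (cases "\<exists>q\<in>Q. y q \<noteq> 0")
    case False
    then show ?thesis by (intro exI[of _ "\<lambda>_. 0"]) auto
  next
    case True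
    then obtain x0 q0 where x0: "x0 \<in> W" "q0 \<in> Q" "\<phi> x0 q0 \<noteq> 0" "\<forall>q\<in>Q. y q = 0 \<longrightarrow> \<phi> x0 q = 0"
      using ex[OF less.prems] by blast
    have "\<phi> x0 q0 * y q0 \<noteq> 0" using x0 by auto
    then obtain x where x: "x \<in> W" "\<And>q. q \<in> Q \<Longrightarrow> y q = 0 \<Longrightarrow> \<phi> x q = 0" "0 < \<phi> x q0 * y q0"
    proof (cases "0 < \<phi> x0 q0 * y q0")
      case False
      obtain x' where "x' \<in> W" "\<phi> x' = (\<lambda>q. - \<phi> x0 q)" using W_uminus[OF x0(1)] by blast
      then show ?thesis using that[of x'] x0(4) False \<open>\<phi> x0 q0 * y q0 \<noteq> 0\<close> by auto
    qed (use that[of x0] x0 in blast)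
    have reduce: "\<exists>\<nu>::'w \<Rightarrow> real. (\<forall>v\<in>W. 0 \<le> \<nu> v \<and> (\<nu> v \<noteq> 0 \<longrightarrow> conformal Q (\<phi> v) y)) \<and>
             (\<exists>t>0. \<forall>q\<in>Q. y q - t * \<phi> z q = (\<Sum>v\<in>W. \<nu> v * \<phi> v q))"
      if z: "z \<in> W" "\<And>q. q \<in> Q \<Longrightarrow> y q = 0 \<Longrightarrow> \<phi> z q = 0" "q1 \<in> Q" "0 < \<phi> z q1 * y q1" for z q1
    proof -
      obtain t where t: "t > 0" "conformal Q (\<lambda>q. y q - t * \<phi> z q) y"
        "card {q\<in>Q. y q - t * \<phi> z q \<noteq> 0} < card {q\<in>Q. y q \<noteq> 0}"
        using conformal_reduce_support[OF Q, of y "\<phi> z" q1] z(2-4) by blast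
      have "(\<lambda>q. y q - t * \<phi> z q) \<in> U" using U[OF less.prems] z(1) WU by blast
      from less.hyps[OF t(3) this] obtain \<nu> :: "'w \<Rightarrow> real"
        where \<nu>: "\<forall>v\<in>W. 0 \<le> \<nu> v \<and> (\<nu> v \<noteq> 0 \<longrightarrow> conformal Q (\<phi> v) (\<lambda>q. y q - t * \<phi> z q))"
          "\<forall>q\<in>Q. y q - t * \<phi> z q = (\<Sum>v\<in>W. \<nu> v * \<phi> v q)" by blast
      have "\<forall>v\<in>W. 0 \<le> \<nu> v \<and> (\<nu> v \<noteq> 0 \<longrightarrow> conformal Q (\<phi> v) y)"
        using \<nu>(1) conformal_trans[OF _ t(2)] by blast
      with \<nu>(2) t(1) show ?thesis by (intro exI[of _ \<nu>] conjI exI[of _ t])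
    qed
    obtain \<nu> t where \<nu>: "\<forall>v\<in>W. 0 \<le> \<nu> v \<and> (\<nu> v \<noteq> 0 \<longrightarrow> conformal Q (\<phi> v) y)"
      "t > 0" "\<forall>q\<in>Q. y q - t * \<phi> x q = (\<Sum>v\<in>W. \<nu> v * \<phi> v q)"
      using reduce[OF x(1,2) x0(2) x(3)] by blast
    show ?thesis
    proof (cases "conformal Q (\<phi> x) y")
      case True
      show ?thesis
      proof (intro exI[of _ "\<lambda>v. \<nu> v + (if v = x then t else 0)"] conjI ballI)
        show "y q = (\<Sum>v\<in>W. (\<nu> v + (if v = x then t else 0)) * \<phi> v q)" if "q \<in> Q" for q
        proof -
          have "(\<Sum>v\<in>W. (\<nu> v + (if v = x then t else 0)) * \<phi> v q) =
                (\<Sum>v\<in>W. \<nu> v * \<phi> v q + (if v = x then t * \<phi> x q else 0))"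
            by (intro sum.cong) (auto simp: distrib_right)
          also have "\<dots> = (\<Sum>v\<in>W. \<nu> v * \<phi> v q) + t * \<phi> x q"
            using W x(1) by (simp add: sum.distrib sum.delta)
          finally show ?thesis using \<nu>(3) that by (metis diff_add_cancel)
        qed
      qed (use \<nu> True in \<open>auto split: if_splits\<close>)
    next
      case False
      \<comment> \<open>As \<open>\<phi> x\<close> vanishes wherever \<open>y\<close> does, a
        violation of conformality is a coordinate with strictly opposite signs. Hence
        \<open>reduce\<close> also applies to the negative of \<open>\<phi> x\<close>.\<close>
      then obtain q1 where q1: "q1 \<in> Q" "\<phi> x q1 * y q1 < 0"
        using x(2) by (force simp: conformal_def mult_less_0_iff)
      obtain \<mu> s where \<mu>: "\<forall>v\<in>W. 0 \<le> \<mu> v \<and> (\<mu> v \<noteq> 0 \<longrightarrow> conformal Q (\<phi> v) y)"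
        "s > 0" "\<forall>q\<in>Q. y q + s * \<phi> x q = (\<Sum>v\<in>W. \<mu> v * \<phi> v q)"
      proof -
        obtain x' where x': "x' \<in> W" "\<phi> x' = (\<lambda>q. - \<phi> x q)" using W_uminus[OF x(1)] by blast
        then show ?thesis using reduce[of x' q1] x(2) q1 that by auto
      qed
      show ?thesis
      \<comment> \<open>With weights \<open>s / (s + t)\<close> and \<open>t / (s + t)\<close>, the
        shifts by \<open>- t * \<phi> x q\<close> and \<open>s * \<phi> x q\<close> cancel.\<close>
      proof (intro exI[of _ "\<lambda>v. (s * \<nu> v + t * \<mu> v) / (s + t)"] conjI ballI)
        show "y q = (\<Sum>v\<in>W. (s * \<nu> v + t * \<mu> v) / (s + t) * \<phi> v q)" if "q \<in> Q" for q
        proof -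
          have "(\<Sum>v\<in>W. (s * \<nu> v + t * \<mu> v) / (s + t) * \<phi> v q) =
                (s * (\<Sum>v\<in>W. \<nu> v * \<phi> v q) + t * (\<Sum>v\<in>W. \<mu> v * \<phi> v q)) / (s + t)"
            by (simp add: sum_divide_distrib sum_distrib_left distrib_right mult.assoc flip: sum.distrib)
          also have "\<dots> = (s * (y q - t * \<phi> x q) + t * (y q + s * \<phi> x q)) / (s + t)"
            using \<nu>(3) \<mu>(3) that by simp
          also have "\<dots> = y q" using \<nu>(2) \<mu>(2) by (simp add: field_simps)
          finally show ?thesis by simp
        qed
        fix v assume v: "v \<in> W"
        show "0 \<le> (s * \<nu> v + t * \<mu> v) / (s + t)" using v \<nu>(1,2) \<mu>(1,2) by simp
        show "(s * \<nu> v + t * \<mu> v) / (s + t) \<noteq> 0 \<longrightarrow> conformal Q (\<phi> v) y"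
          using v \<nu>(1) \<mu>(1) by auto
      qed
    qed
  qed
qed

section \<open>Minors and integer kernel vectors\<close>

lemma det_permute_rows_cols:
  fixes S :: "'a :: comm_ring_1 mat"
  assumes S: "S \<in> carrier_mat k k" and p: "p permutes {0..<k}" and q: "q permutes {0..<k}"
  shows "det (mat k k (\<lambda>(i, j). S $$ (p i, q j))) = signof p * signof q * det S"
proof -
  let ?T = "mat k k (\<lambda>(i, j). S\<^sup>T $$ (q i, j))"
  have "p i < k" "q i < k" if "i < k" for i
    using that permutes_in_image[OF p, of i] permutes_in_image[OF q, of i] by auto
  then have "mat k k (\<lambda>(i, j). S $$ (p i, q j)) = mat k k (\<lambda>(i, j). ?T\<^sup>T $$ (p i, j))"
    using S by (intro eq_matI) auto
  also have "det \<dots> = signof p * det ?T"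
    by (simp add: det_permute_rows[OF _ p] det_transpose[of ?T k])
  also have "det ?T = signof q * det S"
    using S by (simp add: det_permute_rows[OF _ q] det_transpose)
  finally show ?thesis by (simp add: mult.assoc)
qed

text \<open>\<open>submatrix\<close> lists the selected indices in increasing order via
  \<open>pick\<close>. The rank of \<open>f i\<close> in the image of \<open>f\<close> translates
  the enumeration \<open>f\<close> into that order.\<close>

lemma pick_permutation:
  assumes "inj_on f {0..<k}"
  shows "\<exists>p. p permutes {0..<k} \<and> (\<forall>i<k. pick (f ` {0..<k}) (p i) = f i)"
proof -
  let ?R = "f ` {0..<k}"
  define p where "p i = (if i < k then card {a \<in> ?R. a < f i} else i)" for i
  have pick: "pick ?R (p i) = f i" if "i < k" for i
    using that pick_card_in_set[of "f i" ?R] by (auto simp: p_def)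
  have "p i < k" if "i < k" for i
  proof -
    have "card {a \<in> ?R. a < f i} < card ?R" using that by (intro psubset_card_mono) auto
    also have "card ?R = k" using assms by (simp add: card_image)
    finally show ?thesis using that by (simp add: p_def)
  qed
  moreover have "inj_on p {0..<k}"
    using pick assms by (metis (no_types, lifting) atLeastLessThan_iff inj_on_def)
  ultimately have "bij_betw p {0..<k} {0..<k}"
    unfolding bij_betw_def by (intro conjI endo_inj_surj) auto
  then have "p permutes {0..<k}" by (rule bij_imp_permutes) (simp add: p_def)
  then show ?thesis using pick by blast
qed

lemma inj_on_if_det_nonzero:
  fixes A :: "'a :: idom mat"
  assumes "det (mat k k (\<lambda>(i, j). A $$ (f i, g j))) \<noteq> 0"
  shows "inj_on f {0..<k}" "inj_on g {0..<k}"
proof -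
  let ?M = "mat k k (\<lambda>(i, j). A $$ (f i, g j))"
  show "inj_on f {0..<k}"
  proof (rule inj_onI, rule ccontr)
    fix i i' assume "i \<in> {0..<k}" "i' \<in> {0..<k}" "f i = f i'" "i \<noteq> i'"
    then have "det ?M = 0"
      by (intro det_identical_rows[of ?M k i i']) (auto intro!: eq_vecI)
    then show False using assms by simp
  qed
  show "inj_on g {0..<k}"
  proof (rule inj_onI, rule ccontr)
    fix j j' assume "j \<in> {0..<k}" "j' \<in> {0..<k}" "g j = g j'" "j \<noteq> j'"
    then have "det ?M = 0"
      by (intro det_identical_columns[of ?M k j j']) (auto intro!: eq_vecI)
    then show False using assms by simp
  qed
qed

text \<open>Index functions with a repetition give determinant \<open>0\<close>; injective ones give
  a submatrix up to the order of its rows and columns.\<close>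

lemma abs_det_le_max_minor:
  fixes A :: "'a :: linordered_idom mat"
  assumes A: "A \<in> carrier_mat m n" and "0 < k"
    and f: "\<And>i. i < k \<Longrightarrow> f i < m" and g: "\<And>j. j < k \<Longrightarrow> g j < n"
  shows "\<bar>det (mat k k (\<lambda>(i, j). A $$ (f i, g j)))\<bar> \<le> max_minor A"
proof -
  let ?M = "mat k k (\<lambda>(i, j). A $$ (f i, g j))"
  have le: "\<bar>det (submatrix A R C)\<bar> \<le> max_minor A"
    if "R \<subseteq> {0..<m}" "C \<subseteq> {0..<n}" "card R = card C" "card R \<ge> 1" for R C
    using that A finite_abs_minors[of A] unfolding max_minor_def
    by (intro Max_ge) (force simp: abs_minors_def)+
  have "0 < m" "0 < n" using f[OF \<open>0 < k\<close>] g[OF \<open>0 < k\<close>] by auto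
  then have nonneg: "0 \<le> max_minor A"
    by (intro order_trans[OF abs_ge_zero le[of "{0}" "{0}"]]) auto
  show ?thesis
  proof (cases "inj_on f {0..<k} \<and> inj_on g {0..<k}")
    case True
    let ?R = "f ` {0..<k}" and ?C = "g ` {0..<k}"
    obtain p q where p: "p permutes {0..<k}" "\<And>i. i < k \<Longrightarrow> pick ?R (p i) = f i"
      and q: "q permutes {0..<k}" "\<And>i. i < k \<Longrightarrow> pick ?C (q i) = g i"
      using pick_permutation[of f k] pick_permutation[of g k] True by blast
    have "card ?R = k" "card ?C = k" using True by (simp_all add: card_image)
    moreover have "{i. i < dim_row A \<and> i \<in> ?R} = ?R" "{j. j < dim_col A \<and> j \<in> ?C} = ?C"
      using A f g by auto
    ultimately have S: "submatrix A ?R ?C = mat k k (\<lambda>(i, j). A $$ (pick ?R i, pick ?C j))"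
      by (simp add: submatrix_def)
    have "p i < k" "q i < k" if "i < k" for i
      using that permutes_in_image[OF p(1), of i] permutes_in_image[OF q(1), of i] by auto
    then have "?M = mat k k (\<lambda>(i, j). submatrix A ?R ?C $$ (p i, q j))"
      unfolding S by (intro eq_matI) (auto simp: p q)
    then have "det ?M = signof p * signof q * det (submatrix A ?R ?C)"
      using det_permute_rows_cols[OF _ p(1) q(1), of "submatrix A ?R ?C"] by (simp add: S)
    then have "\<bar>det ?M\<bar> = \<bar>det (submatrix A ?R ?C)\<bar>" by (simp add: abs_mult sign_def)
    also have "\<dots> \<le> max_minor A"
      using f g True \<open>0 < k\<close> by (intro le) (auto simp: card_image)
    finally show ?thesis .
  next
    case False
    then have "det ?M = 0" using inj_on_if_det_nonzero by blast
    then show ?thesis using nonneg by simp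
  qed
qed

text \<open>Some entry is a nonzero integer, and entries are minors of size 1.\<close>

lemma one_le_max_minor:
  fixes A :: "int mat"
  assumes A: "A \<in> carrier_mat m n" "A \<noteq> 0\<^sub>m m n"
  shows "1 \<le> max_minor A"
proof -
  obtain r c where rc: "r < m" "c < n" "A $$ (r, c) \<noteq> 0"
    using assms by (metis carrier_matD eq_matI index_zero_mat)
  have "det (mat 1 1 (\<lambda>(i, j). A $$ (r, c))) = A $$ (r, c)"
    by (subst det_single) auto
  then show ?thesis
    using abs_det_le_max_minor[OF A(1), of 1 "\<lambda>_. r" "\<lambda>_. c"] rc by simp
qed

text \<open>Take a nonzero minor of maximal size whose rows lie in \<open>Z\<close> and whose columns lie in the support
  of \<open>y\<close>. It cannot use the whole support, as it would then force \<open>y = 0\<close>. Adding one further column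
  \<open>s\<close> of the support, the signed minors obtained by deleting one of the columns are the entries of a
  vector which is orthogonal to the rows in \<open>Z\<close>: the scalar products are minors of a larger size.\<close>

lemma bounded_integer_kernel_vector:
  fixes A :: "int mat" and y :: "nat \<Rightarrow> real"
  assumes A: "A \<in> carrier_mat m n" "A \<noteq> 0\<^sub>m m n" and Z: "Z \<subseteq> {0..<m}"
    and ker: "\<And>r. r \<in> Z \<Longrightarrow> (\<Sum>c<n. A $$ (r, c) * y c) = 0" and y: "\<exists>c<n. y c \<noteq> 0"
  shows "\<exists>x :: nat \<Rightarrow> int. (\<exists>c<n. x c \<noteq> 0) \<and> (\<forall>c<n. y c = 0 \<longrightarrow> x c = 0) \<and>
           (\<forall>r\<in>Z. (\<Sum>c<n. A $$ (r, c) * x c) = 0) \<and> (\<forall>c<n. \<bar>x c\<bar> \<le> max_minor A)"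
proof -
  define S where "S = {c. c < n \<and> y c \<noteq> 0}"
  have finS: "finite S" by (simp add: S_def)
  \<comment> \<open>Size \<open>0\<close> is allowed: the empty determinant is \<open>1\<close>, so
    \<open>P 0\<close> holds and a maximal size exists.\<close>
  define P where "P k \<longleftrightarrow> (\<exists>f g. (\<forall>i<k. f i \<in> Z \<and> g i \<in> S) \<and>
    det (mat k k (\<lambda>(i, j). A $$ (f i, g j))) \<noteq> 0)" for k
  have "P 0" by (simp add: P_def)
  moreover have bound: "k \<le> card S" if "P k" for k
  proof -
    obtain f g where fg: "\<forall>i<k. f i \<in> Z \<and> g i \<in> S" "det (mat k k (\<lambda>(i, j). A $$ (f i, g j))) \<noteq> 0"
      using \<open>P k\<close> by (auto simp: P_def)
    have "card (g ` {0..<k}) \<le> card S" using fg(1) finS by (intro card_mono) auto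
    then show ?thesis using inj_on_if_det_nonzero(2)[OF fg(2)] by (simp add: card_image)
  qed
  ultimately obtain k where k: "P k" "\<not> P (Suc k)"
    by (metis not_less_eq_eq GreatestI_nat Greatest_le_nat)
  then obtain f g where fg: "\<And>i. i < k \<Longrightarrow> f i \<in> Z" "\<And>i. i < k \<Longrightarrow> g i \<in> S"
    and det: "det (mat k k (\<lambda>(i, j). A $$ (f i, g j))) \<noteq> 0"
    unfolding P_def by blast
  have inj: "inj_on g {0..<k}" by (rule inj_on_if_det_nonzero(2)[OF det])
  \<comment> \<open>Otherwise the restriction of \<open>y\<close> to its support would be a nonzero
    kernel vector of a regular matrix.\<close>
  have "\<not> S \<subseteq> g ` {0..<k}"
  proof
    assume "S \<subseteq> g ` {0..<k}"
    then have S: "S = g ` {0..<k}" using fg by auto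
    let ?N = "map_mat real_of_int (mat k k (\<lambda>(i, j). A $$ (f i, g j)))"
    let ?y = "vec k (\<lambda>j. y (g j))"
    have "?N *\<^sub>v ?y = 0\<^sub>v k"
    proof (intro eq_vecI)
      fix i assume "i < dim_vec (0\<^sub>v k :: real vec)"
      then have i: "i < k" by simp
      then have "(?N *\<^sub>v ?y) $ i = (\<Sum>j\<in>{0..<k}. A $$ (f i, g j) * y (g j))"
        by (simp add: scalar_prod_def)
      also have "\<dots> = (\<Sum>c\<in>S. A $$ (f i, c) * y c)"
        unfolding S by (simp add: sum.reindex[OF inj])
      also have "\<dots> = (\<Sum>c<n. A $$ (f i, c) * y c)"
        by (intro sum.mono_neutral_left) (auto simp: S_def)
      also have "\<dots> = 0" using ker fg(1) i by blast
      finally show "(?N *\<^sub>v ?y) $ i = 0\<^sub>v k $ i" using i by simp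
    qed simp
    moreover have "?y \<noteq> 0\<^sub>v k"
    proof -
      obtain c where "c \<in> S" using y by (auto simp: S_def)
      then obtain j where "j < k" "g j \<in> S" unfolding S by auto
      then have "j < k" "y (g j) \<noteq> 0" by (auto simp: S_def)
      then show ?thesis by (metis index_vec index_zero_vec(1))
    qed
    ultimately have "det ?N = 0"
      by (subst det_0_iff_vec_prod_zero[of _ k]) (auto intro!: exI[of _ ?y])
    then show False using det by (simp add: of_int_hom.hom_det)
  qed
  then obtain s where s: "s \<in> S" "s \<notin> g ` {0..<k}" by blast
  define g' where "g' j = (if j < k then g j else s)" for j
  have g': "g' j \<in> S" for j using fg s by (simp add: g'_def)
  have inj': "inj_on g' {..<Suc k}"
  proof (rule inj_onI)
    have ne: "g i \<noteq> s" if "i < k" for i using that s(2) by auto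
    fix i j assume ij: "i \<in> {..<Suc k}" "j \<in> {..<Suc k}" "g' i = g' j"
    show "i = j"
    proof (cases "i < k \<and> j < k")
      case True
      then show ?thesis using ij(3) inj_onD[OF inj, of i j] by (simp add: g'_def)
    next
      case False
      then show ?thesis using ij ne[of i] ne[of j] by (auto simp: g'_def split: if_splits)
    qed
  qed
  \<comment> \<open>\<open>M r\<close> has row \<open>r\<close> of \<open>A\<close> as its last row
    and column \<open>s\<close> as its last column. The cofactors \<open>cof j\<close> along the
    last row are the same for all \<open>r\<close>, as that row is deleted.\<close>
  define M where "M r = mat (Suc k) (Suc k) (\<lambda>(i, j). A $$ (if i < k then f i else r, g' j))" for r
  define cof where "cof j = (-1) ^ (k + j) *
    det (mat k k (\<lambda>(i, l). A $$ (f i, g' (if l < j then l else Suc l))))" for j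
  have cofactor: "cofactor (M r) k j = cof j" if "j \<le> k" for r j
  proof -
    have "mat_delete (M r) k j = mat k k (\<lambda>(i, l). A $$ (f i, g' (if l < j then l else Suc l)))"
      using that by (intro eq_matI) (auto simp: mat_delete_def M_def)
    then show ?thesis by (simp add: cofactor_def cof_def)
  qed
  \<comment> \<open>As \<open>g'\<close> is injective on \<open>{..<Suc k}\<close>, at most one
    summand counts: \<open>x\<close> has the entry \<open>cof j\<close> at the coordinate
    \<open>g' j\<close>.\<close>
  define x where "x c = (\<Sum>j<Suc k. if g' j = c then cof j else 0)" for c
  have x_g': "x (g' j) = cof j" if "j < Suc k" for j
  proof -
    have "x (g' j) = (\<Sum>i<Suc k. if i = j then cof i else 0)"
      unfolding x_def using inj' that by (intro sum.cong) (auto simp: inj_on_def)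
    then show ?thesis using that by simp
  qed
  have x_0: "x c = 0" if "c \<notin> g' ` {..<Suc k}" for c
    unfolding x_def using that by (intro sum.neutral) auto
  show ?thesis
  proof (intro exI[of _ x] conjI ballI allI impI)
    \<comment> \<open>Deleting column \<open>s\<close> leaves the chosen nonzero minor, so
      \<open>x s\<close> is nonzero.\<close>
    have "cof k = det (mat k k (\<lambda>(i, j). A $$ (f i, g j)))"
    proof -
      have "mat k k (\<lambda>(i, l). A $$ (f i, g' (if l < k then l else Suc l))) =
            mat k k (\<lambda>(i, j). A $$ (f i, g j))"
        by (intro eq_matI) (auto simp: g'_def)
      then show ?thesis by (simp add: cof_def)
    qed
    then show "\<exists>c<n. x c \<noteq> 0"
      using det x_g'[of k] s by (intro exI[of _ s]) (auto simp: g'_def S_def)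
    show "x c = 0" if "c < n" "y c = 0" for c
      using that g' by (intro x_0) (auto simp: S_def)
    show "\<bar>x c\<bar> \<le> max_minor A" if "c < n" for c
    proof (cases "c \<in> g' ` {..<Suc k}")
      case False
      then show ?thesis using x_0 one_le_max_minor[OF A] by simp
    next
      case True
      then obtain j where j: "j < Suc k" "c = g' j" by auto
      have "\<bar>cof j\<bar> \<le> max_minor A"
      \<comment> \<open>For \<open>k = 0\<close> the determinant is the empty one, which is not
        among the minors counted by \<open>max_minor\<close>.\<close>
      proof (cases "k = 0")
        case True
        then show ?thesis using one_le_max_minor[OF A] by (simp add: cof_def abs_mult power_abs)
      next
        case False
        have "f i < m" if "i < k" for i using fg(1)[OF that] Z by auto
        moreover have "g' j < n" for j using g'[of j] by (simp add: S_def)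
        ultimately show ?thesis
          unfolding cof_def abs_mult power_abs using False
          by (simp add: abs_det_le_max_minor[OF A(1), of k f "\<lambda>l. g' (if l < j then l else Suc l)"])
      qed
      then show ?thesis using j x_g' by simp
    qed
    show "(\<Sum>c<n. A $$ (r, c) * x c) = 0" if "r \<in> Z" for r
    proof -
      have sub: "g' ` {..<Suc k} \<subseteq> {..<n}" using g' by (auto simp: S_def)
      have "(\<Sum>c<n. A $$ (r, c) * x c) = (\<Sum>c\<in>g' ` {..<Suc k}. A $$ (r, c) * x c)"
        using x_0 sub by (intro sum.mono_neutral_right) auto
      also have "\<dots> = (\<Sum>j<Suc k. A $$ (r, g' j) * cof j)"
        by (subst sum.reindex[OF inj']) (simp add: x_g' del: lessThan_Suc)
      also have "\<dots> = (\<Sum>j<Suc k. M r $$ (k, j) * cofactor (M r) k j)"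
      proof (intro sum.cong refl)
        fix j assume "j \<in> {..<Suc k}"
        then show "A $$ (r, g' j) * cof j = M r $$ (k, j) * cofactor (M r) k j"
          using cofactor[of j r] by (simp add: M_def)
      qed
      also have "\<dots> = det (M r)"
        by (rule laplace_expansion_row[symmetric]) (auto simp: M_def)
      also have "\<dots> = 0"
      proof (rule ccontr)
        assume "det (M r) \<noteq> 0"
        then have "P (Suc k)"
          unfolding P_def M_def using fg(1) g' that
          by (intro exI[of _ "\<lambda>i. if i < k then f i else r"] exI[of _ g']) auto
        then show False using k(2) by blast
      qed
      finally show ?thesis .
    qed
  qed
qed

section \<open>Optimal solutions\<close>

text \<open>The values \<open>\<phi> x\<close> consist of the coordinates of \<open>x\<close> as well as of the entries of \<open>A x\<close>: then \<open>\<phi> x = 0\<close>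
  forces \<open>x = 0\<close>, and reducing the support of \<open>\<phi> x\<close> works even if \<open>A\<close> has a nontrivial kernel.\<close>

lemma conformal_integer_decomposition:
  fixes A :: "int mat" and y :: "nat \<Rightarrow> real"
  assumes A: "A \<in> carrier_mat m n" "A \<noteq> 0\<^sub>m m n"
  obtains W :: "(nat \<Rightarrow> int) set" and \<nu> :: "(nat \<Rightarrow> int) \<Rightarrow> real" where
    "finite W" "\<forall>v\<in>W. 0 \<le> \<nu> v" "\<forall>v\<in>W. \<forall>c<n. \<bar>v c\<bar> \<le> max_minor A"
    "\<forall>v\<in>W. \<nu> v \<noteq> 0 \<longrightarrow>
      conformal {..<m} (\<lambda>r. \<Sum>c<n. A $$ (r, c) * v c) (\<lambda>r. \<Sum>c<n. A $$ (r, c) * y c)"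
    "\<forall>c<n. y c = (\<Sum>v\<in>W. \<nu> v * v c)"
proof -
  define \<phi> :: "(nat \<Rightarrow> real) \<Rightarrow> nat + nat \<Rightarrow> real"
    where "\<phi> x q = (case q of Inl c \<Rightarrow> x c | Inr r \<Rightarrow> \<Sum>c<n. A $$ (r, c) * x c)"
    for x :: "nat \<Rightarrow> real" and q
  define Q :: "(nat + nat) set" where "Q = Inl ` {..<n} \<union> Inr ` {..<m}"
  \<comment> \<open>Fixing the value \<open>0\<close> outside \<open>{..<n}\<close> makes
    \<open>W\<close> finite.\<close>
  define W :: "(nat \<Rightarrow> int) set"
    where "W = {x. \<forall>c. (c \<in> {..<n} \<longrightarrow> x c \<in> {- max_minor A..max_minor A}) \<and> (c \<notin> {..<n} \<longrightarrow> x c = 0)}"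
  have W: "finite W" unfolding W_def by (intro finite_set_of_finite_funs) auto
  have minus: "\<exists>x'\<in>W. \<phi> (\<lambda>c. real_of_int (x' c)) = (\<lambda>q. - \<phi> (\<lambda>c. real_of_int (x c)) q)" if "x \<in> W" for x
    using that by (intro bexI[of _ "\<lambda>c. - x c"]) (auto simp: W_def \<phi>_def fun_eq_iff sum_negf split: sum.split)
  have sub: "(\<lambda>q. \<phi> y q - t * \<phi> x q) = \<phi> (\<lambda>c. y c - t * x c)" for x y t
    by (auto simp: \<phi>_def fun_eq_iff sum_subtractf sum_distrib_left algebra_simps split: sum.split)
  \<comment> \<open>The kernel vector is taken for the rows in which \<open>A z\<close> vanishes, so
    its image under \<open>\<phi>\<close> vanishes on \<open>Q\<close> wherever
    \<open>\<phi> z\<close> does.\<close>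
  have ex: "\<exists>x\<in>W. (\<exists>q\<in>Q. \<phi> (\<lambda>c. real_of_int (x c)) q \<noteq> 0) \<and>
              (\<forall>q\<in>Q. \<phi> z q = 0 \<longrightarrow> \<phi> (\<lambda>c. real_of_int (x c)) q = 0)"
    if z: "\<exists>q\<in>Q. \<phi> z q \<noteq> 0" for z
  proof -
    have "\<exists>c<n. z c \<noteq> 0"
    proof (rule ccontr)
      assume "\<not> ?thesis"
      then have "\<phi> z q = 0" if "q \<in> Q" for q using that by (auto simp: \<phi>_def Q_def)
      then show False using z by blast
    qed
    moreover have "{r. r < m \<and> \<phi> z (Inr r) = 0} \<subseteq> {0..<m}" by auto
    moreover have "(\<Sum>c<n. A $$ (r, c) * z c) = 0" if "r \<in> {r. r < m \<and> \<phi> z (Inr r) = 0}" for r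
      using that by (simp add: \<phi>_def)
    ultimately obtain x where x: "\<exists>c<n. x c \<noteq> 0" "\<forall>c<n. z c = 0 \<longrightarrow> x c = 0"
      "\<forall>r\<in>{r. r < m \<and> \<phi> z (Inr r) = 0}. (\<Sum>c<n. A $$ (r, c) * x c) = 0" "\<forall>c<n. \<bar>x c\<bar> \<le> max_minor A"
      using bounded_integer_kernel_vector[OF A, of "{r. r < m \<and> \<phi> z (Inr r) = 0}" z] by blast
    define x' where "x' c = (if c < n then x c else 0)" for c
    have int: "(\<Sum>c<n. A $$ (r, c) * real_of_int (x' c)) = of_int (\<Sum>c<n. A $$ (r, c) * x c)" for r
      by (simp add: x'_def)
    have "x' \<in> W" using x(4) by (auto simp: W_def x'_def abs_le_iff)
    moreover have "\<exists>q\<in>Q. \<phi> (\<lambda>c. real_of_int (x' c)) q \<noteq> 0"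
      using x(1) by (force simp: Q_def \<phi>_def x'_def)
    moreover have "\<phi> (\<lambda>c. real_of_int (x' c)) q = 0" if "q \<in> Q" "\<phi> z q = 0" for q
    proof (cases q)
      case (Inl c)
      then show ?thesis using that x(2) by (auto simp: Q_def \<phi>_def x'_def)
    next
      case (Inr r)
      then have "(\<Sum>c<n. A $$ (r, c) * x c) = 0" using that x(3) by (auto simp: Q_def)
      then show ?thesis using Inr int[of r] by (simp add: \<phi>_def)
    qed
    ultimately show ?thesis by blast
  qed
  have "\<exists>\<nu>::(nat \<Rightarrow> int) \<Rightarrow> real.
      (\<forall>v\<in>W. 0 \<le> \<nu> v \<and> (\<nu> v \<noteq> 0 \<longrightarrow> conformal Q (\<phi> (\<lambda>c. real_of_int (v c))) (\<phi> y))) \<and>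
      (\<forall>q\<in>Q. \<phi> y q = (\<Sum>v\<in>W. \<nu> v * \<phi> (\<lambda>c. real_of_int (v c)) q))"
  proof (rule conformal_decomposition[where U = "range \<phi>"])
    show "finite Q" by (simp add: Q_def)
    show "(\<lambda>q. y q - t * x q) \<in> range \<phi>" if "y \<in> range \<phi>" "x \<in> range \<phi>" for x y t
      using that sub by (auto intro: rev_image_eqI)
    show "\<exists>x\<in>W. (\<exists>q\<in>Q. \<phi> (\<lambda>c. real_of_int (x c)) q \<noteq> 0) \<and>
            (\<forall>q\<in>Q. y q = 0 \<longrightarrow> \<phi> (\<lambda>c. real_of_int (x c)) q = 0)"
      if y: "y \<in> range \<phi>" "\<exists>q\<in>Q. y q \<noteq> 0" for y
    proof -
      obtain z where "y = \<phi> z" using y(1) by blast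
      then show ?thesis using ex[of z] y(2) by simp
    qed
  qed (use W minus in auto)
  then obtain \<nu> :: "(nat \<Rightarrow> int) \<Rightarrow> real"
    where \<nu>: "\<forall>v\<in>W. 0 \<le> \<nu> v \<and> (\<nu> v \<noteq> 0 \<longrightarrow> conformal Q (\<phi> (\<lambda>c. real_of_int (v c))) (\<phi> y))"
      "\<forall>q\<in>Q. \<phi> y q = (\<Sum>v\<in>W. \<nu> v * \<phi> (\<lambda>c. real_of_int (v c)) q)" by blast
  have "conformal {..<m} (\<lambda>r. \<Sum>c<n. A $$ (r, c) * v c) (\<lambda>r. \<Sum>c<n. A $$ (r, c) * y c)"
    if v: "v \<in> W" "\<nu> v \<noteq> 0" for v
    unfolding conformal_def
  proof
    fix r assume "r \<in> {..<m}"
    then have "Inr r \<in> Q" by (simp add: Q_def)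
    moreover have "conformal Q (\<phi> (\<lambda>c. real_of_int (v c))) (\<phi> y)" using \<nu>(1) v by blast
    moreover have "\<phi> (\<lambda>c. real_of_int (v c)) (Inr r) = real_of_int (\<Sum>c<n. A $$ (r, c) * v c)"
      by (simp add: \<phi>_def)
    moreover have "\<phi> y (Inr r) = (\<Sum>c<n. A $$ (r, c) * y c)" by (simp add: \<phi>_def)
    ultimately show "(0 < real_of_int (\<Sum>c<n. A $$ (r, c) * v c) \<longrightarrow> 0 < (\<Sum>c<n. A $$ (r, c) * y c)) \<and>
        (real_of_int (\<Sum>c<n. A $$ (r, c) * v c) < 0 \<longrightarrow> (\<Sum>c<n. A $$ (r, c) * y c) < 0)"
      unfolding conformal_def by metis
  qed
  moreover have "y c = (\<Sum>v\<in>W. \<nu> v * v c)" if "c < n" for c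
    using \<nu>(2)[rule_format, of "Inl c"] that by (simp add: Q_def \<phi>_def)
  moreover have "\<bar>v c\<bar> \<le> max_minor A" if "v \<in> W" "c < n" for v c
    using that by (auto simp: W_def abs_le_iff)
  moreover have "0 \<le> \<nu> v" if "v \<in> W" for v using \<nu>(1) that by blast
  ultimately show ?thesis by (intro that[OF W] ballI allI impI)
qed

lemma mip_feasible_iff:
  assumes "A \<in> carrier_mat m n" "b \<in> carrier_vec m"
  shows "x \<in> mip_feasible A b K \<longleftrightarrow> x \<in> carrier_vec n \<and>
           (\<forall>r<m. (\<Sum>c<n. A $$ (r, c) * x $ c) \<le> b $ r) \<and> (\<forall>i\<in>K. x $ i \<in> \<int>)"
proof -
  have "(map_mat real_of_int A *\<^sub>v x) $ r = (\<Sum>c<n. A $$ (r, c) * x $ c)"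
    if "r < m" "x \<in> carrier_vec n" for r
    using that assms by (simp add: scalar_prod_def atLeast0LessThan)
  then show ?thesis using assms by (auto simp: mip_feasible_def less_eq_vec_def)
qed

text \<open>In row \<open>r\<close>, every \<open>v\<close> with nonzero coefficient moves the
  left-hand side in the direction of the total change from \<open>w\<close> to \<open>z\<close>, or
  not at all. If the total change is positive, the partial change with
  \<open>\<theta> \<le> \<nu>\<close> stays below the value at \<open>z\<close>; otherwise no
  \<open>v\<close> increases the left-hand side, which stays below its value at
  \<open>w\<close>.\<close>

lemma conformal_path_feasible:
  fixes A :: "int mat" and w z :: "nat \<Rightarrow> real" and W :: "(nat \<Rightarrow> int) set" and \<nu> \<theta> :: "(nat \<Rightarrow> int) \<Rightarrow> real"
  assumes w: "(\<Sum>c<n. A $$ (r, c) * w c) \<le> \<beta>" and z: "(\<Sum>c<n. A $$ (r, c) * z c) \<le> \<beta>"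
    and zw: "\<forall>c<n. z c - w c = (\<Sum>v\<in>W. \<nu> v * v c)"
    and \<theta>: "\<forall>v\<in>W. 0 \<le> \<theta> v \<and> \<theta> v \<le> \<nu> v"
    and conf: "\<forall>v\<in>W. \<nu> v \<noteq> 0 \<longrightarrow>
      conformal {..<m} (\<lambda>r. \<Sum>c<n. A $$ (r, c) * v c) (\<lambda>r. \<Sum>c<n. A $$ (r, c) * (z c - w c))"
    and "r < m"
  shows "(\<Sum>c<n. A $$ (r, c) * (w c + (\<Sum>v\<in>W. \<theta> v * v c))) \<le> \<beta>"
proof -
  define a where "a v = real_of_int (\<Sum>c<n. A $$ (r, c) * v c)" for v
  have comb: "(\<Sum>c<n. A $$ (r, c) * (\<Sum>v\<in>W. \<eta> v * v c)) = (\<Sum>v\<in>W. \<eta> v * a v)" for \<eta> :: "(nat \<Rightarrow> int) \<Rightarrow> real"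
    unfolding a_def sum_distrib_left of_int_sum
    by (subst sum.swap) (simp add: mult.left_commute)
  have zw': "(\<Sum>c<n. A $$ (r, c) * (z c - w c)) = (\<Sum>v\<in>W. \<nu> v * a v)"
    using zw by (simp flip: comb)
  have sgn: "(0 < a v \<longrightarrow> 0 < (\<Sum>v\<in>W. \<nu> v * a v)) \<and> (a v < 0 \<longrightarrow> (\<Sum>v\<in>W. \<nu> v * a v) < 0)"
    if "v \<in> W" "\<nu> v \<noteq> 0" for v
  proof -
    have "r \<in> {..<m}" using \<open>r < m\<close> by simp
    from bspec[OF conf[rule_format, OF that, unfolded conformal_def] this] show ?thesis
      unfolding zw' a_def[symmetric] .
  qed
  have eq: "(\<Sum>c<n. A $$ (r, c) * (w c + (\<Sum>v\<in>W. \<theta> v * v c))) =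
        (\<Sum>c<n. A $$ (r, c) * w c) + (\<Sum>v\<in>W. \<theta> v * a v)"
    by (simp add: distrib_left sum.distrib comb)
  show ?thesis
  proof (cases "0 < (\<Sum>v\<in>W. \<nu> v * a v)")
    case True
    have "(\<Sum>v\<in>W. \<theta> v * a v) \<le> (\<Sum>v\<in>W. \<nu> v * a v)"
    proof (rule sum_mono)
      fix v assume v: "v \<in> W"
      show "\<theta> v * a v \<le> \<nu> v * a v"
      proof (cases "\<nu> v = 0")
        case False
        then have "0 \<le> a v" using sgn[OF v False] True by linarith
        then show ?thesis using bspec[OF \<theta> v] by (simp add: mult_right_mono)
      next
        case True
        then have "\<theta> v = 0" using bspec[OF \<theta> v] by linarith
        then show ?thesis using True by simp
      qed
    qed
    then show ?thesis using z unfolding eq zw'[symmetric] by (simp add: algebra_simps sum_subtractf)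
  next
    case False
    have "(\<Sum>v\<in>W. \<theta> v * a v) \<le> 0"
    proof (rule sum_nonpos)
      fix v assume v: "v \<in> W"
      show "\<theta> v * a v \<le> 0"
      proof (cases "\<nu> v = 0")
        case nz: False
        then have "a v \<le> 0" using sgn[OF v nz] False by linarith
        then show ?thesis using bspec[OF \<theta> v] by (simp add: mult_nonneg_nonpos)
      next
        case True
        then have "\<theta> v = 0" using bspec[OF \<theta> v] by linarith
        then show ?thesis using True by simp
      qed
    qed
    then show ?thesis using w unfolding eq by simp
  qed
qed

theorem theorem2:
  fixes m n :: nat
    and A :: "int mat" and b :: "int vec" and c :: "real vec"
    and I J :: "nat set"
  assumes "m \<ge> 1" and "n \<ge> 1"
    and "A \<in> carrier_mat m n" and "A \<noteq> 0\<^sub>m m n"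
    and "b \<in> carrier_vec m" and "c \<in> carrier_vec n"
    and "I \<subseteq> {0..<n}" and "J \<subseteq> {0..<n}" and "I \<noteq> J"
    and "\<exists>x. mip_optimal A b c J x"
  shows "\<forall>w. mip_optimal A b c I w \<longrightarrow>
           (\<exists>z. mip_optimal A b c J z \<and>
                max_norm_vec (w - z) < real (card (I \<union> J)) * real_of_int (max_minor A))"
proof (intro allI impI)
  fix w assume w_opt: "mip_optimal A b c I w"
  obtain z0 where z0_opt: "mip_optimal A b c J z0" using assms(10) by blast
  note A = assms(3,4) and feas = mip_feasible_iff[OF assms(3,5)]
  have w: "w \<in> carrier_vec n" "\<And>r. r < m \<Longrightarrow> (\<Sum>k<n. A $$ (r, k) * w $ k) \<le> b $ r" "\<And>i. i \<in> I \<Longrightarrow> w $ i \<in> \<int>"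
    and z0: "z0 \<in> carrier_vec n" "\<And>r. r < m \<Longrightarrow> (\<Sum>k<n. A $$ (r, k) * z0 $ k) \<le> b $ r" "\<And>i. i \<in> J \<Longrightarrow> z0 $ i \<in> \<int>"
    using w_opt z0_opt by (auto simp: mip_optimal_def feas)
  obtain W and \<nu> :: "(nat \<Rightarrow> int) \<Rightarrow> real" where W: "finite W"
    and decomposition: "\<forall>v\<in>W. 0 \<le> \<nu> v" "\<forall>v\<in>W. \<forall>k<n. \<bar>v k\<bar> \<le> max_minor A"
      "\<forall>v\<in>W. \<nu> v \<noteq> 0 \<longrightarrow> conformal {..<m} (\<lambda>r. \<Sum>k<n. A $$ (r, k) * v k)
         (\<lambda>r. \<Sum>k<n. A $$ (r, k) * (z0 $ k - w $ k))"
      "\<forall>k<n. z0 $ k - w $ k = (\<Sum>v\<in>W. \<nu> v * v k)"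
    by (rule conformal_integer_decomposition[OF A, of "\<lambda>k. z0 $ k - w $ k"])
  note \<nu> = decomposition(1)[rule_format] and v_le = decomposition(2)[rule_format] and diff = decomposition(4)[rule_format]
  \<comment> \<open>\<open>I \<noteq> J\<close> makes the union nonempty; a nonnegative residual
    could not be less than the cardinality of an empty set.\<close>
  have IJ: "finite (I \<union> J)" "I \<union> J \<noteq> {}" using assms(7-9) finite_subset by auto
  obtain \<gamma> :: "(nat \<Rightarrow> int) \<Rightarrow> real" where residual: "\<forall>v\<in>W. 0 \<le> \<gamma> v \<and> \<gamma> v \<le> \<nu> v"
      "\<forall>k\<in>I \<union> J. (\<Sum>v\<in>W. \<gamma> v * v k) \<in> \<int>"
    and small: "(\<Sum>v\<in>W. \<nu> v - \<gamma> v) < card (I \<union> J)"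
    by (rule integral_combination_residual[OF IJ W \<nu>, of "\<lambda>v. v"])
  note \<gamma> = residual(1)[rule_format] and int = residual(2)[rule_format]
  define z where "z = vec n (\<lambda>k. w $ k + (\<Sum>v\<in>W. (\<nu> v - \<gamma> v) * v k))"
  define w' where "w' = vec n (\<lambda>k. w $ k + (\<Sum>v\<in>W. \<gamma> v * v k))"
  \<comment> \<open>Seen from \<open>z0\<close>, the point \<open>z\<close> is shifted by a vector
    with integral coordinates in \<open>I \<union> J\<close>, so it inherits integrality on
    \<open>J\<close>.\<close>
  have z_eq: "z $ k = z0 $ k - (\<Sum>v\<in>W. \<gamma> v * v k)" if "k < n" for k
    using diff[OF that] that by (simp add: z_def left_diff_distrib sum_subtractf)
  \<comment> \<open>Used with \<open>\<nu> - \<gamma>\<close> for \<open>z\<close> and with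
    \<open>\<gamma>\<close> for \<open>w'\<close>.\<close>
  have rows: "(\<Sum>k<n. A $$ (r, k) * (w $ k + (\<Sum>v\<in>W. \<theta> v * v k))) \<le> b $ r"
    if "r < m" "\<forall>v\<in>W. 0 \<le> \<theta> v \<and> \<theta> v \<le> \<nu> v" for r and \<theta> :: "(nat \<Rightarrow> int) \<Rightarrow> real"
    by (rule conformal_path_feasible[OF w(2)[OF that(1)] z0(2)[OF that(1)]
          decomposition(4) that(2) decomposition(3) that(1)])
  have "z \<in> mip_feasible A b J"
    unfolding feas
  proof (intro conjI allI impI ballI)
    show "z $ i \<in> \<int>" if "i \<in> J" for i
    proof -
      have "i < n" using that assms(8) by auto
      then show ?thesis using z_eq z0(3)[OF that] int[of i] that by simp
    qed
    show "(\<Sum>k<n. A $$ (r, k) * z $ k) \<le> b $ r" if "r < m" for r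
      using rows[OF that, of "\<lambda>v. \<nu> v - \<gamma> v"] \<gamma> by (simp add: z_def)
  qed (simp add: z_def)
  moreover have "w' \<in> mip_feasible A b I"
    unfolding feas
  proof (intro conjI allI impI ballI)
    show "w' $ i \<in> \<int>" if "i \<in> I" for i
    proof -
      have "i < n" using that assms(7) by auto
      then show ?thesis using w(3)[OF that] int[of i] that by (simp add: w'_def)
    qed
    show "(\<Sum>k<n. A $$ (r, k) * w' $ k) \<le> b $ r" if "r < m" for r
      using rows[OF that, of \<gamma>] \<gamma> by (simp add: w'_def)
  qed (simp add: w'_def)
  then have "c \<bullet> w' \<le> c \<bullet> w" using w_opt by (simp add: mip_optimal_def)
  moreover have "z + w' = z0 + w"
    using z0(1) w(1) z_eq by (intro eq_vecI) (simp_all add: w'_def z_def)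
  then have "c \<bullet> z + c \<bullet> w' = c \<bullet> z0 + c \<bullet> w"
    using scalar_prod_add_distrib[OF assms(6), of z w'] scalar_prod_add_distrib[OF assms(6) z0(1) w(1)]
    by (simp add: z_def w'_def)
  ultimately have "mip_optimal A b c J z"
    using z0_opt by (force simp: mip_optimal_def)
  moreover have "\<bar>(w - z) $ k\<bar> < real (card (I \<union> J)) * real_of_int (max_minor A)" if "k < n" for k
  proof -
    have "\<bar>(w - z) $ k\<bar> = \<bar>\<Sum>v\<in>W. (\<nu> v - \<gamma> v) * v k\<bar>"
      using that w(1) by (simp add: z_def)
    also have "\<dots> \<le> (\<Sum>v\<in>W. (\<nu> v - \<gamma> v) * max_minor A)"
    proof (intro order_trans[OF sum_abs] sum_mono)
      fix v assume v: "v \<in> W"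
      have "\<bar>real_of_int (v k)\<bar> \<le> max_minor A" using v_le[OF v that] by linarith
      then show "\<bar>(\<nu> v - \<gamma> v) * v k\<bar> \<le> (\<nu> v - \<gamma> v) * max_minor A"
        using \<gamma>[OF v] by (simp add: abs_mult mult_left_mono)
    qed
    also have "\<dots> = (\<Sum>v\<in>W. \<nu> v - \<gamma> v) * max_minor A" by (simp add: sum_distrib_right)
    also have "\<dots> < real (card (I \<union> J)) * real_of_int (max_minor A)"
      using small one_le_max_minor[OF A] by (intro mult_strict_right_mono) auto
    finally show ?thesis .
  qed
  \<comment> \<open>\<open>n \<ge> 1\<close> ensures that the maximum is taken over a nonempty
    set.\<close>
  then have "max_norm_vec (w - z) < real (card (I \<union> J)) * real_of_int (max_minor A)"
    unfolding max_norm_vec_def using assms(2) by (subst Max_less_iff) (auto simp: z_def)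
  ultimately show "\<exists>z. mip_optimal A b c J z \<and> max_norm_vec (w - z) < real (card (I \<union> J)) * real_of_int (max_minor A)"
    by blast
qed

end
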